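(* Let $k\ge 1$ be an integer, and let $g\colon S^1\to S^{2k+1}$ be the symmetric moment curve $$g(t)=\tfrac{1}{\sqrt{k+1}}\bigl(\cos t,\sin t,\cos 3t,\sin 3t,\ldots,\cos((2k+1)t),\sin((2k+1)t)\bigr).$$ If $x,x'\in S^{2k+1}$ and $t,t'\in S^1$ satisfy $d(x,g(t))=d(x,g(S^1))$ and $d(x',g(t'))=d(x',g(S^1))$, then $$\bigl|d(x,x')-d(t,t')\bigr|\leq \frac{2\pi k}{2k+1}.$$
   Context: $S^1=\mathbb{R}/2\pi\mathbb{Z}$ with the geodesic metric $d(t,t')=\min_{j\in\mathbb{Z}}|t-t'+2\pi j|$. $S^{2k+1}$ is the unit sphere in $\mathbb{R}^{2k+2}$ with the geodesic metric $d(x,x')=\arccos\langle x,x'\rangle$, where $\langle\cdot,\cdot\rangle$ is the standard Euclidean inner product. The coordinates of $g(t)$ are $\tfrac{1}{\sqrt{k+1}}\cos((2j+1)t)$ and $\tfrac{1}{\sqrt{k+1}}\sin((2j+1)t)$ for $j=0,1,\ldots,k$. For $x\in S^{2k+1}$, $d(x,g(S^1))=\min_{s\in S^1}d(x,g(s))$ denotes the distance from $x$ to the image of $g$. *)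

theory Defs
  imports "HOL-Analysis.Analysis"
begin

definition circle_rel :: "real \<Rightarrow> real \<Rightarrow> bool" where
  "circle_rel t t' \<longleftrightarrow> (\<exists>j::int. t - t' = 2 * pi * of_int j)"

lemma equivp_circle_rel: "equivp circle_rel"
proof (rule equivpI)
  show "reflp circle_rel"
    by (auto simp: reflp_def circle_rel_def intro: exI[of _ 0])
  show "symp circle_rel"
  proof (rule sympI)
    fix a b assume "circle_rel a b"
    then obtain j :: int where "a - b = 2 * pi * of_int j" by (auto simp: circle_rel_def)
    then have "b - a = 2 * pi * of_int (- j)" by simp
    then show "circle_rel b a" unfolding circle_rel_def by blast
  qed
  show "transp circle_rel"
  proof (rule transpI)
    fix a b c assume "circle_rel a b" "circle_rel b c"
    then obtain i j :: int where "a - b = 2 * pi * of_int i" "b - c = 2 * pi * of_int j"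
      by (auto simp: circle_rel_def)
    then have "a - c = 2 * pi * of_int (i + j)" by (simp add: algebra_simps)
    then show "circle_rel a c" unfolding circle_rel_def by blast
  qed
qed

quotient_type circle = real / circle_rel
  by (rule equivp_circle_rel)

lift_definition circle_dist :: "circle \<Rightarrow> circle \<Rightarrow> real" is
  "\<lambda>t t'. INF j::int. \<bar>t - t' + 2 * pi * of_int j\<bar>"
proof -
  fix s s' t t' :: real
  assume "circle_rel s s'" "circle_rel t t'"
  then obtain m n :: int where m: "s = s' + 2 * pi * of_int m" and n: "t = t' + 2 * pi * of_int n"
    by (auto simp: circle_rel_def algebra_simps)
  have "range (\<lambda>j::int. \<bar>s - t + 2 * pi * of_int j\<bar>)
      = (\<lambda>j::int. \<bar>s' - t' + 2 * pi * of_int j\<bar>) ` range (\<lambda>j. j + m - n)"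
    by (simp add: m n image_image algebra_simps)
  also have "range (\<lambda>j. j + m - n) = (UNIV :: int set)"
    by (rule surjI[of _ "\<lambda>j. j - m + n"]) simp
  finally show "(INF j::int. \<bar>s - t + 2 * pi * of_int j\<bar>) = (INF j::int. \<bar>s' - t' + 2 * pi * of_int j\<bar>)"
    by simp
qed

text \<open>
  The sphere \<open>S\<^sup>n\<close> is \<^term>\<open>topspace (nsphere n)\<close>, whose points are functions
  \<^typ>\<open>nat \<Rightarrow> real\<close> vanishing at all indices greater than \<open>n\<close>.
\<close>

definition sphere_dist :: "nat \<Rightarrow> (nat \<Rightarrow> real) \<Rightarrow> (nat \<Rightarrow> real) \<Rightarrow> real" where
  "sphere_dist n x y = arccos (\<Sum>i\<le>n. x i * y i)"

text \<open>
  The coordinates with indices \<open>2 * j\<close> and \<open>2 * j + 1\<close>, for \<open>j \<le> k\<close>, are the multiples of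
  \<open>cos ((2 * j + 1) * t)\<close> and \<open>sin ((2 * j + 1) * t)\<close>.
\<close>

lift_definition sym_moment_curve :: "nat \<Rightarrow> circle \<Rightarrow> nat \<Rightarrow> real" is
  "\<lambda>k t i. if i \<le> 2 * k + 1
     then (if even i then cos (real (2 * (i div 2) + 1) * t) else sin (real (2 * (i div 2) + 1) * t))
            / sqrt (real k + 1)
     else 0"
proof -
  fix k :: nat and s t :: real
  assume "circle_rel s t"
  then obtain m :: int where m: "s = t + 2 * pi * of_int m"
    by (auto simp: circle_rel_def algebra_simps)
  have *: "real n * s = real n * t + 2 * pi * of_int (int n * m)" for n
    by (simp add: m algebra_simps)
  have "cos (real n * s) = cos (real n * t)" "sin (real n * s) = sin (real n * t)" for n
    unfolding * cos_add sin_add by (simp_all only: cos_int_2pin sin_int_2pin mult_1_right mult_zero_right diff_zero add_0_right)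
  then show "(\<lambda>i. if i \<le> 2 * k + 1
     then (if even i then cos (real (2 * (i div 2) + 1) * s) else sin (real (2 * (i div 2) + 1) * s))
            / sqrt (real k + 1)
     else 0) = (\<lambda>i. if i \<le> 2 * k + 1
     then (if even i then cos (real (2 * (i div 2) + 1) * t) else sin (real (2 * (i div 2) + 1) * t))
            / sqrt (real k + 1)
     else 0)" by (simp only:)
qed

lemma sum_atMost_pairs: "(\<Sum>i\<le>2 * k + 1. f i) = (\<Sum>j\<le>k. f (2 * j) + f (2 * j + 1))"
  for f :: "nat \<Rightarrow> real"
  by (induction k) (simp_all add: numeral_2_eq_2)

lemma sym_moment_curve_in_nsphere: "sym_moment_curve k t \<in> topspace (nsphere (2 * k + 1))"
proof transfer
  fix k :: nat and t :: real
  let ?g = "\<lambda>i. if i \<le> 2 * k + 1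
     then (if even i then cos (real (2 * (i div 2) + 1) * t) else sin (real (2 * (i div 2) + 1) * t))
            / sqrt (real k + 1)
     else 0"
  have "(\<Sum>i\<le>2 * k + 1. (?g i)\<^sup>2) = (\<Sum>j\<le>k. (?g (2 * j))\<^sup>2 + (?g (2 * j + 1))\<^sup>2)"
    by (rule sum_atMost_pairs)
  also have "\<dots> = (\<Sum>j\<le>k. 1 / (real k + 1))"
  proof (rule sum.cong)
    fix j assume "j \<in> {..k}"
    then show "(?g (2 * j))\<^sup>2 + (?g (2 * j + 1))\<^sup>2 = 1 / (real k + 1)"
      by (simp add: power_divide flip: add_divide_distrib)
  qed simp
  also have "\<dots> = 1" by simp
  finally show "?g \<in> topspace (nsphere (2 * k + 1))"
    by (simp add: nsphere_def topspace_Euclidean_space)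
qed

definition dist_to_moment_curve :: "nat \<Rightarrow> (nat \<Rightarrow> real) \<Rightarrow> real" where
  "dist_to_moment_curve k x = (INF s. sphere_dist (2 * k + 1) x (sym_moment_curve k s))"

text \<open>The two infima above are minima.\<close>

lemma circle_dist_attained:
  "\<exists>j::int. circle_dist (abs_circle t) (abs_circle t') = \<bar>t - t' + 2 * pi * of_int j\<bar>"
proof -
  let ?f = "\<lambda>j::int. \<bar>t - t' + 2 * pi * of_int j\<bar>"
  define j0 :: int where "j0 = round ((t' - t) / (2 * pi))"
  have "?f j0 \<le> ?f j" for j
  proof -
    have eq: "?f i = 2 * pi * \<bar>of_int i - (t' - t) / (2 * pi)\<bar>" for i :: int
    proof -
      have "t - t' + 2 * pi * of_int i = 2 * pi * (of_int i - (t' - t) / (2 * pi))"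
        by (simp add: field_simps)
      then show ?thesis by (simp add: abs_mult)
    qed
    have "\<bar>of_int j0 - (t' - t) / (2 * pi)\<bar> \<le> \<bar>of_int j - (t' - t) / (2 * pi)\<bar>"
      using round_diff_minimal[of "(t' - t) / (2 * pi)" j]
      by (simp add: j0_def abs_minus_commute)
    then show ?thesis unfolding eq by simp
  qed
  then have "Inf (range ?f) = ?f j0"
    by (intro cInf_eq_minimum) auto
  then show ?thesis
    by (auto simp: circle_dist.abs_eq)
qed

lemma dist_to_moment_curve_attained:
  assumes x: "x \<in> topspace (nsphere (2 * k + 1))"
  shows "\<exists>s. dist_to_moment_curve k x = sphere_dist (2 * k + 1) x (sym_moment_curve k s)"
proof -
  let ?n = "2 * k + 1"
  let ?g = "\<lambda>s. sym_moment_curve k (abs_circle s)"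
  let ?F = "\<lambda>s. sphere_dist ?n x (sym_moment_curve k s)"
  have nx: "(\<Sum>i\<le>?n. (x i)\<^sup>2) = 1"
    using x by (simp add: nsphere_def)
  have ng: "(\<Sum>i\<le>?n. (?g s i)\<^sup>2) = 1" for s
    using sym_moment_curve_in_nsphere[of k "abs_circle s"] by (simp add: nsphere_def)
  have "(\<Sum>i\<le>?n. x i * ?g s i)\<^sup>2 \<le> 1" for s
    using Cauchy_Schwarz_ineq_sum[of x "?g s" "{..?n}"] unfolding nx ng by simp
  then have bound: "- 1 \<le> (\<Sum>i\<le>?n. x i * ?g s i) \<and> (\<Sum>i\<le>?n. x i * ?g s i) \<le> 1" for s
    by (simp only: abs_square_le_1 abs_le_iff minus_le_iff)
  have cg: "continuous_on {0..2 * pi} (\<lambda>s. ?g s i)" for i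
    unfolding sym_moment_curve.abs_eq
    by (cases "i \<le> ?n"; cases "even i") (auto intro!: continuous_intros)
  have "continuous_on {0..2 * pi} (\<lambda>s. ?F (abs_circle s))"
    unfolding sphere_dist_def
    by (intro continuous_on_arccos continuous_intros cg ballI bound)
  then have "\<exists>s0\<in>{0..2 * pi}. \<forall>s\<in>{0..2 * pi}. ?F (abs_circle s0) \<le> ?F (abs_circle s)"
    by (intro continuous_attains_inf) auto
  then obtain s0 where s0: "\<And>s. s \<in> {0..2 * pi} \<Longrightarrow> ?F (abs_circle s0) \<le> ?F (abs_circle s)"
    by blast
  have "?F (abs_circle s0) \<le> ?F c" for c
  proof -
    obtain u where u: "c = abs_circle u" by (metis Quotient_circle Quotient_def)
    define v where "v = u - 2 * pi * of_int \<lfloor>u / (2 * pi)\<rfloor>"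
    have "u = 2 * pi * (u / (2 * pi))" by simp
    then have "v = 2 * pi * frac (u / (2 * pi))"
      unfolding v_def frac_def right_diff_distrib by simp
    then have "v \<in> {0..2 * pi}"
      using frac_ge_0[of "u / (2 * pi)"] frac_lt_1[of "u / (2 * pi)"] by simp
    moreover have "circle_rel u v"
      unfolding circle_rel_def v_def by (intro exI[of _ "\<lfloor>u / (2 * pi)\<rfloor>"]) simp
    then have "abs_circle u = abs_circle v" by (simp add: circle.abs_eq_iff)
    ultimately show ?thesis using s0 u by metis
  qed
  then have "Inf (range ?F) = ?F (abs_circle s0)"
    by (intro cInf_eq_minimum) auto
  then show ?thesis unfolding dist_to_moment_curve_def by blast
qed

end

theory Submission
  imports Defs
begin

text \<open>
  For \<open>x\<close> on the sphere, \<open>P\<^sub>x(s) = \<langle>x, g(s)\<rangle>\<close> is a trigonometric polynomial with odd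
  frequencies up to \<open>n = 2k + 1\<close>, hence antiperiodic under \<open>s \<mapsto> s + \<pi>\<close>, and \<open>g(a)\<close> is a point of the
  curve nearest to \<open>x\<close> iff \<open>\<bar>P\<^sub>x\<bar>\<close> attains its maximum \<open>M\<^sub>x\<close> as \<open>P\<^sub>x(a)\<close>. Two facts hold: Riesz's lemma
  \<open>P\<^sub>x(a + s) \<ge> M\<^sub>x cos(ns)\<close> for \<open>\<bar>s\<bar> \<le> \<pi>/n\<close>, and \<open>M\<^sub>x \<ge> 1/sqrt(n + 1)\<close>, because the points
  \<open>g(\<pi>j/(n + 1))\<close>, \<open>0 \<le> j \<le> n\<close>, form an orthonormal basis.

  Let \<open>P\<^sub>x\<close> be maximal at \<open>a\<close> and \<open>P\<^sub>y\<close> at \<open>b\<close> with \<open>\<delta> = \<bar>a - b\<bar> \<le> \<pi>/n\<close>, and put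
  \<open>u = (\<pi>/n - \<delta>)/2\<close>. Evaluating at the midpoint \<open>h\<close> of \<open>a\<close> and \<open>b\<close>,
  \<open>\<parallel>x + y\<parallel> \<ge> P\<^sub>x(h) + P\<^sub>y(h) \<ge> (M\<^sub>x + M\<^sub>y) sin(nu) \<ge> 2 sin(nu)/sqrt(n + 1) \<ge> 2 sin u\<close>, that is,
  \<open>d(x, y) \<le> \<pi> - \<pi>/n + \<delta>\<close>. Applied to \<open>(x, x')\<close> this bounds \<open>d(x, x') - d(t, t')\<close>; applied to
  \<open>(x, -x')\<close>, with \<open>t'\<close> replaced by its antipode, it bounds \<open>d(t, t') - d(x, x')\<close>.
\<close>

section \<open>Lagrange interpolation with alternating values\<close>

text \<open>In the Lagrange formula for \<open>q\<close>, exactly \<open>j\<close> nodes lie above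
  \<open>y j\<close>, so the denominator \<open>w j\<close> has sign \<open>(- 1) ^ j\<close>, which
  cancels the sign of \<open>poly q (y j)\<close>. To the right of the largest node
  \<open>y 0\<close> every term is then nonnegative.\<close>

lemma poly_nonneg_if_alternating:
  fixes q :: "real poly" and y :: "nat \<Rightarrow> real"
  assumes deg: "degree q < m"
    and dec: "\<And>i j. i < j \<Longrightarrow> j < m \<Longrightarrow> y j < y i"
    and alt: "\<And>j. j < m \<Longrightarrow> 0 \<le> (- 1) ^ j * poly q (y j)"
    and z: "y 0 \<le> z"
  shows "0 \<le> poly q z"
proof -
  define w where "w j = (\<Prod>i\<in>{..<m} - {j}. y j - y i)" for j
  define L where "L = (\<Sum>j<m. smult (poly q (y j) / w j) (\<Prod>i\<in>{..<m} - {j}. [:- y i, 1:]))"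
  have inj: "inj_on y {..<m}"
    by (rule linorder_inj_onI) (use dec in force)+
  have w0: "w j \<noteq> 0" if "j < m" for j
    unfolding w_def using inj that by (auto simp: inj_on_def)
  have "degree (\<Prod>i\<in>{..<m} - {j}. [:- y i, 1:]) = m - 1" if "j < m" for j
    using that by (subst degree_prod_sum_eq) auto
  then have "degree L \<le> m - 1"
    unfolding L_def by (intro degree_sum_le) (auto intro: order_trans[OF degree_smult_le])
  then have "degree L < m" using deg by linarith
  moreover have "poly L (y l) = poly q (y l)" if l: "l < m" for l
  proof -
    have "poly L (y l) = (\<Sum>j<m. poly q (y j) / w j * (\<Prod>i\<in>{..<m} - {j}. y l - y i))"
      by (simp add: L_def poly_sum poly_prod)
    also have "\<dots> = (\<Sum>j<m. if j = l then poly q (y l) else 0)"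
    proof (rule sum.cong)
      fix j assume "j \<in> {..<m}"
      show "poly q (y j) / w j * (\<Prod>i\<in>{..<m} - {j}. y l - y i) = (if j = l then poly q (y l) else 0)"
      proof (cases "j = l")
        case True
        then show ?thesis using w0[OF l] by (simp flip: w_def)
      next
        case False
        then have "(\<Prod>i\<in>{..<m} - {j}. y l - y i) = 0" using l by (intro prod_zero) auto
        then show ?thesis using False by simp
      qed
    qed simp
    also have "\<dots> = poly q (y l)" using l by simp
    finally show ?thesis .
  qed
  moreover have "card (y ` {..<m}) = m" using card_image[OF inj] by simp
  ultimately have "q = L"
    using deg by (intro poly_eqI_degree[where A = "y ` {..<m}"]) auto
  then have "poly q z = poly L z" by simp
  also have "\<dots> = (\<Sum>j<m. poly q (y j) / w j * (\<Prod>i\<in>{..<m} - {j}. z - y i))"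
    by (simp add: L_def poly_sum poly_prod)
  also have "\<dots> \<ge> 0"
  proof (intro sum_nonneg mult_nonneg_nonneg prod_nonneg)
    fix j i assume "j \<in> {..<m}" "i \<in> {..<m} - {j}"
    then have "y i \<le> y 0" using dec[of 0 i] by (cases "i = 0") auto
    then show "0 \<le> z - y i" using z by simp
  next
    fix j assume "j \<in> {..<m}"
    then have j: "j < m" by simp
    have split: "{..<m} - {j} = {..<j} \<union> {j<..<m}" using j by auto
    have "w j = (\<Prod>i<j. - 1 * (y i - y j)) * (\<Prod>i\<in>{j<..<m}. y j - y i)"
      unfolding w_def split by (subst prod.union_disjoint) auto
    also have "\<dots> = (- 1) ^ j * ((\<Prod>i<j. y i - y j) * (\<Prod>i\<in>{j<..<m}. y j - y i))"
      unfolding prod.distrib by simp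
    finally have w: "w j = (- 1) ^ j * ((\<Prod>i<j. y i - y j) * (\<Prod>i\<in>{j<..<m}. y j - y i))"
      (is "_ = _ * ?c") .
    have "?c \<ge> 0"
      by (intro mult_nonneg_nonneg prod_nonneg) (auto intro!: less_imp_le dec simp: j)
    moreover have "poly q (y j) / w j = (- 1) ^ j * poly q (y j) / ?c"
      unfolding w by (cases "even j") auto
    ultimately show "0 \<le> poly q (y j) / w j"
      using alt[OF j] by simp
  qed
  finally show ?thesis .
qed

section \<open>Homogeneous forms in sine and cosine\<close>

text \<open>Homogeneity is the point: division by \<open>sin s ^ n\<close> turns such a form into a
  polynomial in \<open>cot s\<close>, to which interpolation applies.\<close>

definition sin_cos_form :: "nat \<Rightarrow> (real \<Rightarrow> real) \<Rightarrow> bool" where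
  "sin_cos_form n f \<longleftrightarrow> (\<exists>a. \<forall>s. f s = (\<Sum>i\<le>n. a i * sin s ^ i * cos s ^ (n - i)))"

lemma sin_cos_form_add:
  assumes "sin_cos_form n f" "sin_cos_form n g"
  shows "sin_cos_form n (\<lambda>s. f s + g s)"
proof -
  obtain a b where "\<And>s. f s = (\<Sum>i\<le>n. a i * sin s ^ i * cos s ^ (n - i))"
    "\<And>s. g s = (\<Sum>i\<le>n. b i * sin s ^ i * cos s ^ (n - i))"
    using assms unfolding sin_cos_form_def by blast
  then show ?thesis unfolding sin_cos_form_def
    by (intro exI[of _ "\<lambda>i. a i + b i"]) (simp add: sum.distrib distrib_right)
qed

lemma sin_cos_form_scale:
  assumes "sin_cos_form n f"
  shows "sin_cos_form n (\<lambda>s. c * f s)"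
proof -
  obtain a where "\<And>s. f s = (\<Sum>i\<le>n. a i * sin s ^ i * cos s ^ (n - i))"
    using assms unfolding sin_cos_form_def by blast
  then show ?thesis unfolding sin_cos_form_def
    by (intro exI[of _ "\<lambda>i. c * a i"]) (simp add: sum_distrib_left mult.assoc)
qed

lemma sin_cos_form_sum:
  assumes "\<And>i. i \<in> I \<Longrightarrow> sin_cos_form n (f i)"
  shows "sin_cos_form n (\<lambda>s. \<Sum>i\<in>I. f i s)"
proof -
  have "sin_cos_form n (\<lambda>s. 0)"
    unfolding sin_cos_form_def by (intro exI[of _ "\<lambda>i. 0"]) simp
  then show ?thesis
    using assms by (induction I rule: infinite_finite_induct) (auto intro: sin_cos_form_add)
qed

lemma sin_cos_form_sin_mult:
  assumes "sin_cos_form n f"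
  shows "sin_cos_form (Suc n) (\<lambda>s. sin s * f s)"
proof -
  obtain a where "\<And>s. f s = (\<Sum>i\<le>n. a i * sin s ^ i * cos s ^ (n - i))"
    using assms unfolding sin_cos_form_def by blast
  then show ?thesis unfolding sin_cos_form_def
    by (intro exI[of _ "\<lambda>i. case i of 0 \<Rightarrow> 0 | Suc j \<Rightarrow> a j"])
      (simp add: sum.atMost_Suc_shift sum_distrib_left mult_ac del: sum.atMost_Suc)
qed

lemma sin_cos_form_cos_mult:
  assumes "sin_cos_form n f"
  shows "sin_cos_form (Suc n) (\<lambda>s. cos s * f s)"
proof -
  obtain a where a: "\<And>s. f s = (\<Sum>i\<le>n. a i * sin s ^ i * cos s ^ (n - i))"
    using assms unfolding sin_cos_form_def by blast
  \<comment> \<open>Nothing is known about \<open>a\<close> beyond index \<open>n\<close>, so the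
    new top coefficient is set to 0.\<close>
  have "cos s * f s = (\<Sum>i\<le>Suc n. (if i \<le> n then a i else 0) * sin s ^ i * cos s ^ (Suc n - i))" for s
    by (simp add: a sum_distrib_left Suc_diff_le mult_ac)
  then show ?thesis unfolding sin_cos_form_def
    by (intro exI[of _ "\<lambda>i. if i \<le> n then a i else 0"] allI)
qed

lemma sin_cos_form_cos_sin_multiple:
  "sin_cos_form m (\<lambda>s. cos (real m * s))" "sin_cos_form m (\<lambda>s. sin (real m * s))"
proof (induction m)
  case 0
  show "sin_cos_form 0 (\<lambda>s. cos (real 0 * s))"
    unfolding sin_cos_form_def by (intro exI[of _ "\<lambda>i. 1"]) simp
  show "sin_cos_form 0 (\<lambda>s. sin (real 0 * s))"
    unfolding sin_cos_form_def by (intro exI[of _ "\<lambda>i. 0"]) simp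
next
  case (Suc m)
  have "(\<lambda>s. cos (real (Suc m) * s)) = (\<lambda>s. cos s * cos (real m * s) + (- 1) * (sin s * sin (real m * s)))"
    by (simp add: fun_eq_iff algebra_simps cos_add)
  then show "sin_cos_form (Suc m) (\<lambda>s. cos (real (Suc m) * s))"
    using Suc by (simp only: sin_cos_form_add sin_cos_form_scale sin_cos_form_sin_mult sin_cos_form_cos_mult)
  have "(\<lambda>s. sin (real (Suc m) * s)) = (\<lambda>s. sin s * cos (real m * s) + cos s * sin (real m * s))"
    by (simp add: fun_eq_iff algebra_simps sin_add)
  then show "sin_cos_form (Suc m) (\<lambda>s. sin (real (Suc m) * s))"
    using Suc by (simp only: sin_cos_form_add sin_cos_form_sin_mult sin_cos_form_cos_mult)
qed

text \<open>Multiplication by \<open>1 = sin\<^sup>2 + cos\<^sup>2\<close> raises the degree by 2.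
  Frequencies of the same parity as \<open>n\<close> can thus be brought to the common degree
  \<open>n\<close>.\<close>

lemma sin_cos_form_raise:
  assumes "sin_cos_form n f"
  shows "sin_cos_form (n + 2 * d) f"
proof (induction d)
  case (Suc d)
  have "f = (\<lambda>s. sin s * (sin s * f s) + cos s * (cos s * f s))"
    by (simp add: fun_eq_iff flip: mult.assoc distrib_right power2_eq_square)
  moreover have "sin_cos_form (Suc (Suc (n + 2 * d))) (\<lambda>s. sin s * (sin s * f s) + cos s * (cos s * f s))"
    by (intro sin_cos_form_add sin_cos_form_sin_mult sin_cos_form_cos_mult Suc)
  ultimately show ?case by simp
qed (use assms in simp)

section \<open>Riesz's lemma\<close>

text \<open>The difference \<open>cot a - cot b\<close> equals
  \<open>sin (b - a) / (sin a * sin b)\<close>.\<close>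

lemma cot_strict_antimono:
  assumes "0 < a" "a < b" "b < pi"
  shows "cot b < cot a"
proof -
  have "sin a > 0" "sin b > 0" "sin (b - a) > 0"
    using assms by (auto intro!: sin_gt_zero)
  then show ?thesis
    by (simp add: cot_def field_simps sin_diff)
qed

text \<open>
  Since \<open>f - f(0) cos(ns)\<close> has a double zero at \<open>0\<close>, it is \<open>sin\<^sup>n s \<cdot> q(cot s)\<close> for a polynomial \<open>q\<close> of
  degree at most \<open>n - 2\<close>, and \<open>q\<close> alternates in sign at the \<open>n - 1\<close> points \<open>cot(j\<pi>/n)\<close>, the extremal
  points of \<open>cos(ns)\<close> in \<open>(0, \<pi>)\<close>.
\<close>

lemma sin_cos_form_ge_cos_pos:
  assumes form: "sin_cos_form n f" and n: "n \<ge> 2"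
    and bound: "\<And>s. \<bar>f s\<bar> \<le> f 0"
    and s: "0 < s" "s \<le> pi / n"
  shows "f 0 * cos (real n * s) \<le> f s"
proof -
  define D :: "real \<Rightarrow> real" where "D s = f s - f 0 * cos (real n * s)" for s
  have "sin_cos_form n (\<lambda>s. f s + (- f 0) * cos (real n * s))"
    by (intro sin_cos_form_add form sin_cos_form_scale sin_cos_form_cos_sin_multiple)
  then obtain a where a: "\<And>s. D s = (\<Sum>i\<le>n. a i * sin s ^ i * cos s ^ (n - i))"
    unfolding sin_cos_form_def D_def by auto
  obtain m where m: "n = Suc (Suc m)" using n by (metis add_2_eq_Suc le_Suc_ex)
  define G :: "real \<Rightarrow> real" where "G s = (\<Sum>i\<le>m. a (Suc (Suc i)) * sin s ^ i * cos s ^ (m - i))" for s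
  \<comment> \<open>The terms of order 0 and 1 in \<open>sin s\<close> are split off; showing that
    \<open>a 0\<close> and \<open>a 1\<close> vanish gives the double zero.\<close>
  have D: "D s = a 0 * cos s ^ n + a 1 * sin s * cos s ^ Suc m + (sin s)\<^sup>2 * G s" for s
    unfolding a m G_def
    by (simp add: sum.atMost_Suc_shift sum_distrib_left power2_eq_square mult_ac del: sum.atMost_Suc)
  have a0: "a 0 = 0" using D[of 0] by (simp add: D_def)
  obtain G' where G': "(G has_real_derivative G') (at 0)"
  proof -
    have "G differentiable (at 0)"
      unfolding G_def[abs_def] real_differentiable_def
      by (rule exI) (auto intro!: derivative_eq_intros)
    then show ?thesis using that by (auto simp: real_differentiable_def)
  qed
  have "(D has_real_derivative a 1) (at 0)"
    unfolding D[abs_def] a0 by (auto intro!: derivative_eq_intros G')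
  \<comment> \<open>\<open>cos (real n * s)\<close> has derivative 0 at 0, so \<open>f\<close> has
    the same derivative \<open>a 1\<close> there as \<open>D\<close>; it vanishes because
    \<open>f\<close> is maximal at 0.\<close>
  then have "((\<lambda>s. D s + f 0 * cos (real n * s)) has_real_derivative a 1) (at 0)"
    by (auto intro!: derivative_eq_intros)
  then have "(f has_real_derivative a 1) (at 0)"
    by (simp add: D_def)
  then have a1: "a 1 = 0"
    by (rule DERIV_local_max[of _ _ _ 1]) (use bound in \<open>auto intro: order_trans[OF abs_ge_self]\<close>)
  define q where "q = (\<Sum>i\<le>m. monom (a (Suc (Suc i))) (m - i))"
  have Dq: "D s = sin s ^ n * poly q (cot s)" if "sin s \<noteq> 0" for s
  proof -
    have "sin s ^ m * poly q (cot s) = G s"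
      unfolding q_def G_def poly_sum sum_distrib_left
    proof (rule sum.cong)
      fix i assume "i \<in> {..m}"
      then have "sin s ^ m = sin s ^ i * sin s ^ (m - i)" by (simp flip: power_add)
      then show "sin s ^ m * poly (monom (a (Suc (Suc i))) (m - i)) (cot s)
          = a (Suc (Suc i)) * sin s ^ i * cos s ^ (m - i)"
        using that by (simp add: poly_monom cot_def power_divide)
    qed simp
    then show ?thesis using D[of s] a0 a1 by (simp add: m power2_eq_square)
  qed
  have "degree q \<le> m"
    unfolding q_def by (intro degree_sum_le) (auto intro: order_trans[OF degree_monom_le])
  \<comment> \<open>Nodes are counted from 0, hence \<open>Suc j\<close>: the largest is
    \<open>y 0 = cot (pi / n)\<close>, and there are \<open>m + 1\<close> of them for degree at most
    \<open>m\<close>.\<close>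
  define y where "y j = cot (real (Suc j) * pi / n)" for j
  have node: "0 < real (Suc j) * pi / n" "real (Suc j) * pi / n < pi" if "j < Suc m" for j
  proof -
    have "real (Suc j) * pi < real n * pi"
      using that by (intro mult_strict_right_mono) (auto simp: m)
    then show "real (Suc j) * pi / n < pi" using n by (simp add: divide_less_eq mult.commute)
    show "0 < real (Suc j) * pi / n" using n by (intro divide_pos_pos mult_pos_pos) auto
  qed
  have "0 \<le> poly q (cot s)"
  proof (rule poly_nonneg_if_alternating)
    show "degree q < Suc m" using \<open>degree q \<le> m\<close> by simp
    show "y j < y i" if "i < j" "j < Suc m" for i j
      unfolding y_def
      by (rule cot_strict_antimono) (use that node[of i] node[of j] in \<open>auto simp: m divide_strict_right_mono\<close>)
    show "0 \<le> (- 1) ^ j * poly q (y j)" if "j < Suc m" for j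
    proof -
      define \<theta> where "\<theta> = real (Suc j) * pi / n"
      have sn: "sin \<theta> > 0" using node[OF that] unfolding \<theta>_def by (rule sin_gt_zero)
      have "real n * \<theta> = pi * real (Suc j)" by (simp add: m \<theta>_def)
      \<comment> \<open>The index shift gives the sign opposite to \<open>(- 1) ^ j\<close>, so
        \<open>f 0\<close> enters the next line with a plus sign and dominates
        \<open>f \<theta>\<close>.\<close>
      then have "cos (real n * \<theta>) = (- 1) ^ Suc j" by (simp only: cos_npi2)
      then have "(- 1) ^ j * D \<theta> = (- 1) ^ j * f \<theta> + f 0"
        unfolding D_def by (cases "even j") simp_all
      also have "\<dots> \<ge> 0" using bound[of \<theta>] by (cases "even j") auto
      finally have "0 \<le> sin \<theta> ^ n * ((- 1) ^ j * poly q (cot \<theta>))"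
        using Dq[of \<theta>] sn by (simp add: mult_ac)
      then have "0 \<le> (- 1) ^ j * poly q (cot \<theta>)"
        using sn by (intro mult_left_le_imp_le[of "sin \<theta> ^ n" 0]) auto
      then show ?thesis unfolding y_def \<theta>_def .
    qed
    show "y 0 \<le> cot s"
    proof (cases "s = pi / n")
      case False
      then have "cot (pi / n) < cot s"
        using s n node[of 0] by (intro cot_strict_antimono) auto
      then show ?thesis by (simp add: y_def)
    qed (simp add: y_def)
  qed
  moreover have "sin s > 0"
    using s node[of 0] by (intro sin_gt_zero) auto
  ultimately have "D s \<ge> 0" using Dq[of s] by simp
  then show ?thesis by (simp add: D_def)
qed

lemma sin_cos_form_reflect:
  assumes "sin_cos_form n f"
  shows "sin_cos_form n (\<lambda>s. f (- s))"
proof -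
  obtain a where "\<And>s. f s = (\<Sum>i\<le>n. a i * sin s ^ i * cos s ^ (n - i))"
    using assms unfolding sin_cos_form_def by blast
  then show ?thesis unfolding sin_cos_form_def
    by (intro exI[of _ "\<lambda>i. (- 1) ^ i * a i"]) (simp add: power_minus[of "sin _"] mult_ac)
qed

lemma sin_cos_form_ge_cos:
  assumes form: "sin_cos_form n f" and n: "n \<ge> 2"
    and bound: "\<And>s. \<bar>f s\<bar> \<le> f 0"
    and s: "\<bar>s\<bar> \<le> pi / n"
  shows "f 0 * cos (real n * s) \<le> f s"
proof -
  consider "s = 0" | "s > 0" | "s < 0" by linarith
  then show ?thesis
  proof cases
    case 2
    then show ?thesis using sin_cos_form_ge_cos_pos[OF form n bound, of s] s by simp
  next
    case 3
    then show ?thesis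
      using sin_cos_form_ge_cos_pos[OF sin_cos_form_reflect[OF form] n, of "- s"] bound s by simp
  qed simp
qed


section \<open>A sine inequality\<close>

text \<open>For \<open>n \<ge> 5\<close> a linear lower bound \<open>sin v \<ge> 7/12 v\<close> on
  \<open>[0, pi/2]\<close> suffices, since \<open>sqrt (n + 1) \<le> 7/12 n\<close>. For
  \<open>n = 3\<close> no linear bound can work, because equality holds at \<open>u = pi/6\<close>
  while \<open>sin u < u\<close>; there the triple angle formula and \<open>sin u \<le> 1/2\<close>
  are used.\<close>

lemma sqrt_mult_sin_le_sin_multiple:
  assumes n: "odd n" "n \<ge> 3" and u: "0 \<le> u" "u \<le> pi / (2 * real n)"
  shows "sqrt (real n + 1) * sin u \<le> sin (real n * u)"
proof (cases "n = 3")
  case True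
  have "sin u \<le> sin (pi / 6)"
    using u True by (intro sin_monotone_2pi_le) auto
  moreover have "sin u \<ge> 0"
    using u True by (intro sin_ge_zero) auto
  ultimately have "(sin u)\<^sup>2 \<le> (1 / 2)\<^sup>2"
    by (intro power_mono) (auto simp: sin_30)
  then have "sin u * (1 - 4 * (sin u)\<^sup>2) \<ge> 0"
    using \<open>sin u \<ge> 0\<close> by (intro mult_nonneg_nonneg) (auto simp: power2_eq_square)
  moreover have "sin (3 * u) = 3 * sin u - 4 * sin u ^ 3"
  proof -
    have "sin (3 * u) = sin (u + 2 * u)" by simp
    also have "\<dots> = sin u * (1 - 2 * (sin u)\<^sup>2) + 2 * sin u * (cos u)\<^sup>2"
      by (simp only: sin_add sin_double cos_double_sin) (simp add: power2_eq_square)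
    also have "\<dots> = 3 * sin u - 4 * sin u ^ 3"
      unfolding cos_squared_eq by (simp add: algebra_simps power2_eq_square power3_eq_cube)
    finally show ?thesis .
  qed
  ultimately show ?thesis
    by (simp add: True algebra_simps power2_eq_square power3_eq_cube)
next
  case False
  then have n5: "n \<ge> 5" using n by (cases "n = 4") auto
  define v where "v = real n * u"
  have v: "0 \<le> v" "v \<le> pi / 2" using u n by (auto simp: v_def field_simps)
  \<comment> \<open>1.58 is slightly above \<open>pi/2\<close>, yet small enough that
    \<open>1 - 1.58\<^sup>2 / 6 \<ge> 7/12\<close>.\<close>
  have "v \<le> 1.58" using v(2) pi_approx by simp
  then have "v\<^sup>2 \<le> 1.58\<^sup>2" using v by (intro power_mono) auto
  then have "v * (7 / 12) \<le> v * (1 - v\<^sup>2 / 6)"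
    using v by (intro mult_left_mono) (auto simp: power2_eq_square)
  also have "\<dots> \<le> sin v"
  proof -
    have "\<bar>sin v - v\<bar> \<le> v ^ 3 / 6"
      using Maclaurin_sin_bound[of v 3] v
      by (simp add: sin_coeff_def numeral_3_eq_3 power2_eq_square fact_numeral algebra_simps)
    then have "v - v ^ 3 / 6 \<le> sin v" by linarith
    then show ?thesis by (simp add: right_diff_distrib power2_eq_square power3_eq_cube)
  qed
  finally have lower: "7 / 12 * v \<le> sin v" by simp
  have "real n + 1 \<le> (7 / 12 * real n)\<^sup>2"
  proof -
    have "real n * 5 \<le> real n * real n" using n5 by (intro mult_left_mono) auto
    moreover have "real n \<ge> 5" using n5 by simp
    ultimately have "144 * real n + 144 \<le> 49 * (real n * real n)" by linarith
    then show ?thesis by (simp add: power2_eq_square)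
  qed
  then have sqrt: "sqrt (real n + 1) \<le> 7 / 12 * real n"
    by (intro real_le_lsqrt) auto
  have "sqrt (real n + 1) * sin u \<le> sqrt (real n + 1) * u"
    using sin_x_le_x[of u] u by (intro mult_left_mono) auto
  also have "\<dots> \<le> 7 / 12 * v"
    using mult_right_mono[OF sqrt u(1)] by (simp add: v_def)
  finally show ?thesis using lower by (simp add: v_def)
qed


section \<open>An orthonormal system of points on the curve\<close>

text \<open>Multiplied by \<open>2 sin a\<close> with \<open>a = pi l / N\<close>, the sum
  telescopes between two sines whose arguments differ by \<open>2 pi l\<close>. The divisibility
  hypothesis says that \<open>sin a\<close> is nonzero.\<close>

lemma sum_cos_equidistant:
  fixes l :: int and N :: nat
  assumes "\<not> int N dvd l" and "N > 0"
  shows "(\<Sum>j<N. cos (2 * pi * l * j / N - \<phi>)) = 0"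
proof -
  define a where "a = pi * l / N"
  define h where "h j = sin ((2 * real j - 1) * a - \<phi>)" for j
  have "sin a \<noteq> 0"
  proof
    assume "sin a = 0"
    then obtain i :: int where "a = of_int i * pi" unfolding sin_zero_iff_int2 by blast
    then have "real_of_int l = real_of_int (i * int N)"
      using \<open>N > 0\<close> by (simp add: a_def field_simps)
    then have "l = i * int N" by (simp only: of_int_eq_iff)
    then show False using assms by simp
  qed
  have "2 * sin a * cos (2 * pi * l * j / N - \<phi>) = h (Suc j) - h j" for j
  proof -
    have "2 * pi * l * j / N - \<phi> = 2 * a * j - \<phi>" by (simp add: a_def)
    moreover have "h (Suc j) = sin ((2 * a * j - \<phi>) + a)" "h j = sin ((2 * a * j - \<phi>) - a)"
      by (simp_all add: h_def algebra_simps)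
    ultimately show ?thesis by (simp add: sin_add sin_diff)
  qed
  then have "2 * sin a * (\<Sum>j<N. cos (2 * pi * l * j / N - \<phi>)) = h N - h 0"
    by (simp add: sum_distrib_left sum_lessThan_telescope)
  also have "h N = sin ((- a - \<phi>) + 2 * pi * of_int l)"
    using \<open>N > 0\<close> by (simp add: h_def a_def field_simps)
  also have "\<dots> = h 0"
    by (simp only: sin_add sin_int_2pin cos_int_2pin) (simp add: h_def)
  finally show ?thesis using \<open>sin a \<noteq> 0\<close> by simp
qed

text \<open>Writing sines as cosines with phase \<open>pi/2\<close> lets one product-to-sum formula
  serve all pairs of coordinates.\<close>

lemma sym_moment_curve_coord:
  assumes "i \<le> 2 * k + 1"
  shows "sym_moment_curve k (abs_circle s) i
    = cos (real (2 * (i div 2) + 1) * s - (if even i then 0 else pi / 2)) / sqrt (real k + 1)"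
  using assms by (simp add: sym_moment_curve.abs_eq cos_diff del: of_nat_add of_nat_Suc)

text \<open>Product-to-sum yields two equidistant cosine sums, with \<open>l = p - q\<close> and
  \<open>l = p + q + 1\<close> in \<open>sum_cos_equidistant\<close>. As \<open>p\<close> and
  \<open>q\<close> lie in \<open>[0, k]\<close>, both are smaller than \<open>N\<close> in absolute
  value, so only \<open>p = q\<close> can contribute.\<close>

lemma sym_moment_curve_orthogonal:
  assumes i: "i \<le> 2 * k + 1" and l: "l \<le> 2 * k + 1"
  defines "N \<equiv> 2 * k + 2"
  shows "(\<Sum>j<N. sym_moment_curve k (abs_circle (pi * real j / N)) i
      * sym_moment_curve k (abs_circle (pi * real j / N)) l) = (if i = l then 1 else 0)"
proof -
  define p q where "p = int (i div 2)" and "q = int (l div 2)"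
  define \<phi> where "\<phi> r = (if even r then 0 else pi / 2)" for r :: nat
  have pq: "p \<ge> 0" "q \<ge> 0" "p \<le> int k" "q \<le> int k"
    using i l by (auto simp: p_def q_def)
  have "sym_moment_curve k (abs_circle (pi * real j / N)) i * sym_moment_curve k (abs_circle (pi * real j / N)) l
      = (cos (2 * pi * (p - q) * j / N - (\<phi> i - \<phi> l)) + cos (2 * pi * (p + q + 1) * j / N - (\<phi> i + \<phi> l)))
        / N" for j
  proof -
    have *: "2 * pi * w * j / N = 2 * w * (pi * real j / N)" for w by simp
    define A where "A = real (2 * (i div 2) + 1) * (pi * real j / N) - \<phi> i"
    define B where "B = real (2 * (l div 2) + 1) * (pi * real j / N) - \<phi> l"
    have AB: "2 * pi * (p - q) * j / N - (\<phi> i - \<phi> l) = A - B"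
      "2 * pi * (p + q + 1) * j / N - (\<phi> i + \<phi> l) = A + B"
      unfolding * A_def B_def p_def q_def by (simp_all add: algebra_simps)
    have "real N = 2 * (real k + 1)" by (simp add: N_def)
    then show ?thesis
      unfolding AB sym_moment_curve_coord[OF i] sym_moment_curve_coord[OF l] \<phi>_def[symmetric]
        A_def[symmetric] B_def[symmetric] times_divide_times_eq
      by (simp add: cos_add cos_diff) (simp add: field_simps)
  qed
  then have "(\<Sum>j<N. sym_moment_curve k (abs_circle (pi * real j / N)) i
      * sym_moment_curve k (abs_circle (pi * real j / N)) l)
      = ((\<Sum>j<N. cos (2 * pi * (p - q) * j / N - (\<phi> i - \<phi> l)))
        + (\<Sum>j<N. cos (2 * pi * (p + q + 1) * j / N - (\<phi> i + \<phi> l)))) / N"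
    by (simp only: sum.distrib flip: sum_divide_distrib)
  also have "(\<Sum>j<N. cos (2 * pi * (p + q + 1) * j / N - (\<phi> i + \<phi> l))) = 0"
    using pq by (intro sum_cos_equidistant) (auto simp: N_def dest!: zdvd_imp_le)
  also have "(\<Sum>j<N. cos (2 * pi * (p - q) * j / N - (\<phi> i - \<phi> l))) = (if i = l then real N else 0)"
  \<comment> \<open>Equal frequencies still leave a cosine paired with a sine; their phases differ
    by \<open>pi/2\<close>, so the constant summand is \<open>cos (pi/2) = 0\<close>.\<close>
  proof (cases "p = q")
    case True
    then have "i = l \<longleftrightarrow> (even i \<longleftrightarrow> even l)"
      unfolding p_def q_def by (metis even_two_times_div_two odd_two_times_div_two_succ of_nat_eq_iff)
    then show ?thesis using True by (auto simp: \<phi>_def)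
  next
    case False
    have "\<not> int N dvd p - q"
    proof
      assume "int N dvd p - q"
      then have "\<bar>int N\<bar> \<le> \<bar>p - q\<bar>" using False by (intro dvd_imp_le_int) auto
      then show False using pq by (simp add: N_def)
    qed
    moreover have "i \<noteq> l" using False by (auto simp: p_def q_def)
    moreover have "N > 0" by (simp add: N_def)
    ultimately show ?thesis using sum_cos_equidistant[of N "p - q" "\<phi> i - \<phi> l"] by simp
  qed
  finally show ?thesis by (simp add: N_def)
qed

section \<open>The trigonometric polynomial of a point of the sphere\<close>

text \<open>This is \<open>P\<^sub>x\<close> of the overview, taken on real parameters so that
  midpoints and shifts make sense.\<close>

definition moment_product :: "nat \<Rightarrow> (nat \<Rightarrow> real) \<Rightarrow> real \<Rightarrow> real" where
  "moment_product k x s = (\<Sum>i\<le>2 * k + 1. x i * sym_moment_curve k (abs_circle s) i)"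

lemma moment_product_add: "moment_product k (\<lambda>i. x i + y i) s = moment_product k x s + moment_product k y s"
  by (simp add: moment_product_def distrib_right sum.distrib)

lemma moment_product_minus: "moment_product k (\<lambda>i. - x i) s = - moment_product k x s"
  by (simp add: moment_product_def sum_negf)

lemma moment_product_antipode: "moment_product k x (s + pi) = - moment_product k x s"
proof -
  have "sym_moment_curve k (abs_circle (s + pi)) i = - sym_moment_curve k (abs_circle s) i"
    if "i \<le> 2 * k + 1" for i
  proof -
    define m where "m = 2 * (i div 2) + 1"
    have "real m * (s + pi) - c = (real m * s - c) + real m * pi" for c
      by (simp add: algebra_simps)
    moreover have "odd m" by (simp add: m_def)
    ultimately show ?thesis
      unfolding sym_moment_curve_coord[OF that] m_def[symmetric]
      by (simp only: cos_add cos_npi sin_npi) simp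
  qed
  then show ?thesis by (simp add: moment_product_def flip: sum_negf)
qed

text \<open>Each frequency \<open>m\<close> is odd, as is \<open>2 * k + 1\<close>, so its terms can
  be raised to that degree. The shift by \<open>c\<close> serves to move a maximum to 0, where
  Riesz's lemma expects it.\<close>

lemma sin_cos_form_moment_product: "sin_cos_form (2 * k + 1) (\<lambda>s. moment_product k x (c + s))"
  unfolding moment_product_def
proof (rule sin_cos_form_sum)
  fix i assume "i \<in> {..2 * k + 1}"
  then have i: "i \<le> 2 * k + 1" by simp
  define m where "m = 2 * (i div 2) + 1"
  define \<phi> where "\<phi> = (if even i then 0 else pi / 2)"
  have mk: "m + 2 * (k - i div 2) = 2 * k + 1" using i by (simp add: m_def)
  have *: "real m * (c + s) - \<phi> = (real m * c - \<phi>) + real m * s" for s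
    by (simp add: algebra_simps)
  have "(\<lambda>s. x i * sym_moment_curve k (abs_circle (c + s)) i)
      = (\<lambda>s. x i / sqrt (real k + 1)
        * (cos (real m * c - \<phi>) * cos (real m * s) + (- sin (real m * c - \<phi>)) * sin (real m * s)))"
    unfolding sym_moment_curve_coord[OF i] m_def[symmetric] \<phi>_def[symmetric] * cos_add by simp
  then show "sin_cos_form (2 * k + 1) (\<lambda>s. x i * sym_moment_curve k (abs_circle (c + s)) i)"
    unfolding mk[symmetric]
    by (simp only: sin_cos_form_raise sin_cos_form_scale sin_cos_form_add sin_cos_form_cos_sin_multiple)
qed

lemma moment_product_parseval:
  defines "N k \<equiv> 2 * k + 2"
  shows "(\<Sum>j<N k. (moment_product k x (pi * real j / N k))\<^sup>2) = (\<Sum>i\<le>2 * k + 1. (x i)\<^sup>2)"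
proof -
  let ?g = "\<lambda>j. sym_moment_curve k (abs_circle (pi * real j / N k))"
  have "(\<Sum>j<N k. (moment_product k x (pi * real j / N k))\<^sup>2)
      = (\<Sum>j<N k. \<Sum>i\<le>2 * k + 1. \<Sum>l\<le>2 * k + 1. x i * x l * (?g j i * ?g j l))"
    by (simp add: moment_product_def power2_eq_square sum_product mult_ac del: sum.atMost_Suc)
  also have "\<dots> = (\<Sum>i\<le>2 * k + 1. \<Sum>l\<le>2 * k + 1. \<Sum>j<N k. x i * x l * (?g j i * ?g j l))"
    by (subst sum.swap) (intro sum.cong refl sum.swap)
  also have "\<dots> = (\<Sum>i\<le>2 * k + 1. \<Sum>l\<le>2 * k + 1. x i * x l * (if i = l then 1 else 0))"
    by (intro sum.cong refl)
      (simp only: N_def sum_distrib_left[symmetric] sym_moment_curve_orthogonal atMost_iff)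
  also have "\<dots> = (\<Sum>i\<le>2 * k + 1. \<Sum>l\<le>2 * k + 1. if i = l then (x i)\<^sup>2 else 0)"
    by (intro sum.cong refl) (simp add: power2_eq_square)
  also have "\<dots> = (\<Sum>i\<le>2 * k + 1. (x i)\<^sup>2)"
    by (simp add: sum.delta')
  finally show ?thesis .
qed

text \<open>By Parseval the \<open>2 * k + 2\<close> squared values at the nodes add up to 1, and
  each is at most \<open>M\<^sup>2\<close>.\<close>

lemma moment_product_max_lower_bound:
  assumes norm: "(\<Sum>i\<le>2 * k + 1. (x i)\<^sup>2) = 1" and bound: "\<And>s. \<bar>moment_product k x s\<bar> \<le> M"
  shows "1 / sqrt (2 * real k + 2) \<le> M"
proof -
  have M: "M \<ge> 0" using bound[of 0] by linarith
  have "1 = (\<Sum>j<2 * k + 2. (moment_product k x (pi * real j / real (2 * k + 2)))\<^sup>2)"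
    unfolding moment_product_parseval norm ..
  also have "\<dots> \<le> (\<Sum>j<2 * k + 2. M\<^sup>2)"
    by (intro sum_mono) (metis bound abs_ge_zero power2_abs power_mono)
  also have "\<dots> = (2 * real k + 2) * M\<^sup>2" by simp
  finally have "1 / (2 * real k + 2) \<le> M\<^sup>2" by (simp add: field_simps)
  then have "sqrt (1 / (2 * real k + 2)) \<le> M" using M by (rule real_le_lsqrt[rotated])
  then show ?thesis by (simp add: real_sqrt_divide)
qed

text \<open>Cauchy-Schwarz with a unit vector \<open>g(s)\<close>; \<open>x\<close> is left
  unnormalized for the later application to \<open>x + y\<close>.\<close>

lemma moment_product_le_norm: "(moment_product k x s)\<^sup>2 \<le> (\<Sum>i\<le>2 * k + 1. (x i)\<^sup>2)"
  using Cauchy_Schwarz_ineq_sum[of x "sym_moment_curve k (abs_circle s)" "{..2 * k + 1}"]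
    sym_moment_curve_in_nsphere[of k "abs_circle s"]
  by (simp add: moment_product_def nsphere_def del: sum.atMost_Suc)

lemma inner_product_bounded:
  fixes x y :: "nat \<Rightarrow> real"
  assumes "(\<Sum>i\<in>I. (x i)\<^sup>2) = 1" "(\<Sum>i\<in>I. (y i)\<^sup>2) = 1"
  shows "\<bar>\<Sum>i\<in>I. x i * y i\<bar> \<le> 1"
  using Cauchy_Schwarz_ineq_sum[of x y I] assms by (simp add: abs_square_le_1)

lemma nearest_imp_moment_product_max:
  assumes x: "x \<in> topspace (nsphere (2 * k + 1))"
    and near: "sphere_dist (2 * k + 1) x (sym_moment_curve k (abs_circle a)) = dist_to_moment_curve k x"
  shows "\<bar>moment_product k x s\<bar> \<le> moment_product k x a"
proof -
  have nx: "(\<Sum>i\<le>2 * k + 1. (x i)\<^sup>2) = 1" using x by (simp add: nsphere_def del: sum.atMost_Suc)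
  have le1: "\<bar>moment_product k x s\<bar> \<le> 1" for s
    using moment_product_le_norm[of k x s] unfolding nx abs_square_le_1 .
  have dist: "sphere_dist (2 * k + 1) x (sym_moment_curve k (abs_circle s)) = arccos (moment_product k x s)" for s
    by (simp only: sphere_dist_def moment_product_def)
  have "moment_product k x s \<le> moment_product k x a" for s
  proof -
    have "bdd_below (range (\<lambda>c. sphere_dist (2 * k + 1) x (sym_moment_curve k c)))"
    proof (rule bdd_belowI2[of _ 0])
      fix c
      obtain u where "c = abs_circle u" by (metis Quotient_circle Quotient_def)
      then show "0 \<le> sphere_dist (2 * k + 1) x (sym_moment_curve k c)"
        using le1[of u] by (simp only: dist) (intro arccos_lbound; simp add: abs_le_iff)
    qed
    then have "dist_to_moment_curve k x \<le> sphere_dist (2 * k + 1) x (sym_moment_curve k (abs_circle s))"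
      unfolding dist_to_moment_curve_def by (intro cINF_lower) auto
    then have "arccos (moment_product k x a) \<le> arccos (moment_product k x s)"
      unfolding near[symmetric] dist .
    then show ?thesis using le1 by (simp only: arccos_le_mono)
  qed
  \<comment> \<open>By antiperiodicity the value at \<open>s + pi\<close> is the negative of the
    value at \<open>s\<close>, so the maximum bounds the absolute value.\<close>
  from this[of s] this[of "s + pi"] show ?thesis by (simp add: moment_product_antipode)
qed

section \<open>The distance estimate\<close>

lemma sphere_dist_le_if_max_near:
  fixes k :: nat and a b :: real
  defines "n \<equiv> 2 * real k + 1"
  assumes k: "k \<ge> 1"
    and nx: "(\<Sum>i\<le>2 * k + 1. (x i)\<^sup>2) = 1" and ny: "(\<Sum>i\<le>2 * k + 1. (y i)\<^sup>2) = 1"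
    and xa: "\<And>s. \<bar>moment_product k x s\<bar> \<le> moment_product k x a"
    and yb: "\<And>s. \<bar>moment_product k y s\<bar> \<le> moment_product k y b"
    and ab: "\<bar>a - b\<bar> \<le> pi / n"
  shows "sphere_dist (2 * k + 1) x y \<le> pi - pi / n + \<bar>a - b\<bar>"
proof -
  define c where "c = (\<Sum>i\<le>2 * k + 1. x i * y i)"
  \<comment> \<open>Chosen so that \<open>n * \<bar>a - b\<bar> / 2 = pi / 2 - n * u\<close> and the
    claimed bound is \<open>pi - 2 * u\<close>.\<close>
  define u where "u = (pi / n - \<bar>a - b\<bar>) / 2"
  define h where "h = (a + b) / 2"
  have n: "n = real (2 * k + 1)" "n \<ge> 3" using k by (auto simp: n_def)
  have u: "0 \<le> u" "u \<le> pi / (2 * n)" using ab by (auto simp: u_def field_simps)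
  have mid: "moment_product k z d * sin (n * u) \<le> moment_product k z h"
    if zd: "\<And>s. \<bar>moment_product k z s\<bar> \<le> moment_product k z d" and hd: "\<bar>h - d\<bar> = \<bar>a - b\<bar> / 2" for z d
  proof -
    have "\<bar>h - d\<bar> \<le> \<bar>a - b\<bar>" unfolding hd by simp
    then have "\<bar>h - d\<bar> \<le> pi / real (2 * k + 1)" using ab unfolding n(1) by (rule order_trans)
    \<comment> \<open>Riesz's lemma for the function recentred at \<open>d\<close>;
      \<open>d + 0\<close> is the form in which its value at 0 appears.\<close>
    then have "moment_product k z (d + 0) * cos (real (2 * k + 1) * (h - d)) \<le> moment_product k z (d + (h - d))"
      using k zd by (intro sin_cos_form_ge_cos[OF sin_cos_form_moment_product]) auto
    moreover have "cos (n * (h - d)) = sin (n * u)"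
    proof -
      have "cos (n * (h - d)) = cos \<bar>n * (h - d)\<bar>" by (simp only: cos_abs_real)
      also have "\<bar>n * (h - d)\<bar> = n * (\<bar>a - b\<bar> / 2)" unfolding abs_mult hd using n(2) by simp
      also have "\<dots> = pi / 2 - n * u" using n(2) by (simp add: u_def field_simps)
      also have "cos \<dots> = sin (n * u)" by (simp add: cos_diff)
      finally show ?thesis .
    qed
    ultimately show ?thesis unfolding n(1) by simp
  qed
  have h: "\<bar>h - a\<bar> = \<bar>a - b\<bar> / 2" "\<bar>h - b\<bar> = \<bar>a - b\<bar> / 2"
    by (auto simp: h_def abs_if field_simps)
  have sin: "sqrt (n + 1) * sin u \<le> sin (n * u)"
    using sqrt_mult_sin_le_sin_multiple[of "2 * k + 1" u] k u unfolding n(1)[symmetric] by simp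
  have "pi / (2 * n) \<le> pi / 2" using n by (simp add: field_simps)
  then have su: "sin u \<ge> 0" using u by (intro sin_ge_zero) auto
  have "sin u \<le> moment_product k z d * sin (n * u)"
    if "1 / sqrt (n + 1) \<le> moment_product k z d" for z d
  proof -
    have "sin u = 1 / sqrt (n + 1) * (sqrt (n + 1) * sin u)" using n by simp
    also have "\<dots> \<le> moment_product k z d * sin (n * u)"
      using that sin su n by (intro mult_mono') auto
    finally show ?thesis .
  qed
  moreover have "1 / sqrt (n + 1) \<le> moment_product k x a" "1 / sqrt (n + 1) \<le> moment_product k y b"
    using moment_product_max_lower_bound[OF nx xa] moment_product_max_lower_bound[OF ny yb]
    by (simp_all add: n_def add.commute)
  ultimately have "2 * sin u \<le> moment_product k (\<lambda>i. x i + y i) h"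
    using mid[OF xa h(1)] mid[OF yb h(2)] unfolding moment_product_add by (smt (verit))
  \<comment> \<open>Both sides are squared to compare with the squared norm of \<open>x + y\<close>,
    which is \<open>2 + 2 * c\<close>; hence
    \<open>c \<ge> 2 (sin u)\<^sup>2 - 1 = - cos (2 * u)\<close>.\<close>
  then have "(2 * sin u)\<^sup>2 \<le> (moment_product k (\<lambda>i. x i + y i) h)\<^sup>2"
    using su by (intro power_mono) auto
  also have "\<dots> \<le> (\<Sum>i\<le>2 * k + 1. (x i + y i)\<^sup>2)" by (rule moment_product_le_norm)
  also have "\<dots> = 2 + 2 * c"
    unfolding power2_sum sum.distrib nx ny c_def by (simp add: sum_distrib_left mult.assoc)
  finally have "- cos (2 * u) \<le> c" by (simp add: cos_double_sin power2_eq_square)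
  then have "cos (pi - 2 * u) \<le> c" by simp
  then have "arccos c \<le> arccos (cos (pi - 2 * u))"
    using inner_product_bounded[OF nx ny] by (subst arccos_le_mono) (auto simp: c_def)
  also have "\<dots> = pi - 2 * u"
    using u \<open>pi / (2 * n) \<le> pi / 2\<close> by (intro arccos_cos) auto
  also have "\<dots> = pi - pi / n + \<bar>a - b\<bar>" unfolding u_def by (simp add: diff_divide_distrib)
  finally show ?thesis unfolding sphere_dist_def c_def .
qed

lemma circle_dist_representatives:
  obtains a b where "t = abs_circle a" "t' = abs_circle b" "circle_dist t t' = \<bar>a - b\<bar>" "\<bar>a - b\<bar> \<le> pi"
proof -
  obtain a b0 where ab0: "t = abs_circle a" "t' = abs_circle b0"
    by (metis Quotient_circle Quotient_def)
  obtain j :: int where j: "circle_dist t t' = \<bar>a - b0 + 2 * pi * of_int j\<bar>"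
    using circle_dist_attained[of a b0] ab0 by auto
  define b where "b = b0 - 2 * pi * of_int j"
  have "circle_rel b0 b" unfolding circle_rel_def b_def by (intro exI[of _ j]) simp
  then have t': "t' = abs_circle b" using ab0 by (simp add: circle.abs_eq_iff)
  have d: "circle_dist t t' = \<bar>a - b\<bar>" using j by (simp add: b_def)
  have le: "circle_dist t t' \<le> \<bar>a - b + 2 * pi * of_int i\<bar>" for i :: int
    unfolding ab0(1) t' circle_dist.abs_eq by (intro cINF_lower bdd_belowI2[of _ 0]) auto
  \<comment> \<open>Shifting by \<open>2 pi\<close> in either direction does not shorten the
    distance between the lifts, so it is at most half a turn.\<close>
  have "\<bar>a - b\<bar> \<le> pi" using le[of 1] le[of "- 1"] pi_gt_zero unfolding d by (simp only: of_int_1 of_int_minus)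
  then show ?thesis using that ab0(1) t' d by blast
qed

theorem theorem1:
  fixes k :: nat and x x' :: "nat \<Rightarrow> real" and t t' :: circle
  assumes "k \<ge> 1"
    and "x \<in> topspace (nsphere (2 * k + 1))"
    and "x' \<in> topspace (nsphere (2 * k + 1))"
    and "sphere_dist (2 * k + 1) x (sym_moment_curve k t) = dist_to_moment_curve k x"
    and "sphere_dist (2 * k + 1) x' (sym_moment_curve k t') = dist_to_moment_curve k x'"
  shows "\<bar>sphere_dist (2 * k + 1) x x' - circle_dist t t'\<bar> \<le> 2 * pi * real k / (2 * real k + 1)"
proof -
  define n where "n = 2 * real k + 1"
  obtain a b where ab: "t = abs_circle a" "t' = abs_circle b"
    and d: "circle_dist t t' = \<bar>a - b\<bar>" and pi: "\<bar>a - b\<bar> \<le> pi"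
    by (rule circle_dist_representatives)
  have nx: "(\<Sum>i\<le>2 * k + 1. (x i)\<^sup>2) = 1" and nx': "(\<Sum>i\<le>2 * k + 1. (x' i)\<^sup>2) = 1"
    using assms(2,3) by (simp_all add: nsphere_def del: sum.atMost_Suc)
  have xa: "\<bar>moment_product k x s\<bar> \<le> moment_product k x a" for s
    using assms(2,4) unfolding ab(1) by (rule nearest_imp_moment_product_max)
  have xb: "\<bar>moment_product k x' s\<bar> \<le> moment_product k x' b" for s
    using assms(3,5) unfolding ab(2) by (rule nearest_imp_moment_product_max)
  have c: "\<bar>\<Sum>i\<le>2 * k + 1. x i * x' i\<bar> \<le> 1" by (rule inner_product_bounded[OF nx nx'])
  have \<theta>: "0 \<le> sphere_dist (2 * k + 1) x x'" "sphere_dist (2 * k + 1) x x' \<le> pi"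
    unfolding sphere_dist_def using c by (auto intro!: arccos_lbound arccos_ubound simp only: abs_le_iff)
  \<comment> \<open>When \<open>\<bar>a - b\<bar>\<close> exceeds \<open>pi / n\<close>, the trivial
    bound \<open>pi\<close> on the sphere distance suffices.\<close>
  have upper: "sphere_dist (2 * k + 1) x x' - \<bar>a - b\<bar> \<le> pi - pi / n"
  proof (cases "\<bar>a - b\<bar> \<le> pi / n")
    case True
    then show ?thesis
      using sphere_dist_le_if_max_near[OF assms(1) nx nx' xa xb] unfolding n_def by simp
  qed (use \<theta> in linarith)
  define y where "y i = - x' i" for i
  \<comment> \<open>A lift of the antipode of \<open>t'\<close>, on the side of \<open>b\<close>
    towards \<open>a\<close>, so that \<open>\<bar>a - e\<bar>\<close> is exactly
    \<open>pi - \<bar>a - b\<bar>\<close>.\<close>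
  define e where "e = (if a \<ge> b then b + pi else b - pi)"
  have ny: "(\<Sum>i\<le>2 * k + 1. (y i)\<^sup>2) = 1" using nx' by (simp add: y_def del: sum.atMost_Suc)
  have "moment_product k y e = moment_product k x' b"
    using moment_product_antipode[of k x' b] moment_product_antipode[of k x' "b - pi"]
    by (simp add: y_def[abs_def] e_def moment_product_minus)
  then have ye: "\<bar>moment_product k y s\<bar> \<le> moment_product k y e" for s
    using xb by (simp add: y_def[abs_def] moment_product_minus)
  have e: "\<bar>a - e\<bar> = pi - \<bar>a - b\<bar>" using pi by (auto simp: e_def)
  have \<theta>y: "sphere_dist (2 * k + 1) x y = pi - sphere_dist (2 * k + 1) x x'"
    using c by (simp add: sphere_dist_def y_def sum_negf arccos_minus abs_le_iff del: sum.atMost_Suc)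
  \<comment> \<open>In the near case both distances are replaced by their complements to
    \<open>pi\<close>; in the far case \<open>\<bar>a - b\<bar> < pi - pi / n\<close>
    already.\<close>
  have lower: "\<bar>a - b\<bar> - sphere_dist (2 * k + 1) x x' \<le> pi - pi / n"
  proof (cases "\<bar>a - e\<bar> \<le> pi / n")
    case True
    then show ?thesis
      using sphere_dist_le_if_max_near[OF assms(1) nx ny xa ye] \<theta>y e unfolding n_def by simp
  qed (use \<theta> e in linarith)
  have "pi - pi / n = 2 * pi * real k / (2 * real k + 1)"
    by (simp add: n_def field_simps)
  then show ?thesis using upper lower d by linarith
qed

end
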